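(* Let $\Omega\subset\mathbb{R}^N$ be an open set, and let $q\in[1,\infty)$, $r\in(0,1)$ be such that $rq\le N$. Let $u\in W^{r,q}_{loc}(\Omega,\mathbb{R}^d)$. Then for $\mathcal{H}^{N-rq}$-a.e. $x\in\Omega$, $$\lim_{\rho\to0^+}\fint_{B_\rho(x)}\left|u(z)-u_{B_\rho(x)}\right|^q\,dz=\lim_{\rho\to0^+}\fint_{B_\rho(x)}\left\{\fint_{B_\rho(x)}|u(z)-u(y)|^q\,dy\right\}dz=0 .$$ That is, $\mathcal{H}^{N-rq}(\mathcal{S}'_u)=0$.
   Context: $N,d$ are natural numbers ($\geq 1$). $\mathcal{H}^{s}$ is $s$-dimensional Hausdorff measure, $\fint$ denotes the average with respect to Lebesgue measure, and $u_{B_\rho(x)}:=\fint_{B_\rho(x)}u(w)\,dw$. For an open set $\Omega_0$, $u\in W^{r,q}(\Omega_0,\mathbb{R}^d)$ means $u\in L^q(\Omega_0,\mathbb{R}^d)$ and $\int_{\Omega_0}\int_{\Omega_0}\frac{|u(x)-u(y)|^q}{|x-y|^{N+rq}}\,dy\,dx<\infty$. $u\in W^{r,q}_{loc}(\Omega,\mathbb{R}^d)$ means $u\in W^{r,q}(\Omega_0,\mathbb{R}^d)$ for every open $\Omega_0\subset\subset\Omega$. For $u\in L^1_{loc}(\Omega,\mathbb{R}^d)$, $\mathcal{S}'_u$ is the set of points $x\in\Omega$ for which the property $$\lim_{\rho\to0^+}\left(\inf_{c\in\mathbb{R}^d}\fint_{B_\rho(x)}|u(y)-c|\,dy\right)=0$$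 does not hold. *)

theory Defs
  imports "HOL-Analysis.Analysis"
begin

text \<open>
  Size of a covering set in the construction of the \<open>s\<close>-dimensional Hausdorff measure, with the
  usual normalisation by \<open>\<omega>\<^sub>s = \<pi>\<^bsup>s/2\<^esup> / \<Gamma>(s/2 + 1)\<close>.  The case \<open>s = 0\<close> is separate because
  \<open>0 powr 0 = 0\<close> in HOL, whereas every nonempty set, points included, must have size 1 there
  (so that the zero-dimensional measure is the counting measure).
\<close>
definition hausdorff_size :: "real \<Rightarrow> 'a::metric_space set \<Rightarrow> ennreal" where
  "hausdorff_size s E =
     (if E = {} then 0
      else if s = 0 then 1
      else ennreal (unit_ball_vol s * (diameter E / 2) powr s))"

definition hausdorff_premeasure :: "real \<Rightarrow> real \<Rightarrow> 'a::metric_space set \<Rightarrow> ennreal" where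
  "hausdorff_premeasure s \<delta> A =
     (INF C \<in> {C :: nat \<Rightarrow> 'a set. A \<subseteq> (\<Union>i. C i) \<and> (\<forall>i. bounded (C i) \<and> diameter (C i) \<le> \<delta>)}.
        (\<Sum>i. hausdorff_size s (C i)))"

text \<open>
  The Hausdorff (outer) measure, defined for all sets.  A property holds almost everywhere in a
  set with respect to it iff the exceptional points of that set have outer measure 0.
\<close>
definition hausdorff_measure :: "real \<Rightarrow> 'a::metric_space set \<Rightarrow> ennreal" where
  "hausdorff_measure s A = (SUP \<delta> \<in> {0<..}. hausdorff_premeasure s \<delta> A)"

definition average :: "'a::euclidean_space set \<Rightarrow> ('a \<Rightarrow> 'b::euclidean_space) \<Rightarrow> 'b" where
  "average A f = (LINT x:A|lebesgue. f x) /\<^sub>R measure lebesgue A"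

text \<open>
  Averages of nonnegative functions are taken in \<open>[0, \<infinity>]\<close>, so that no integrability side condition
  is hidden in the default value 0 of the Bochner integral.
\<close>
definition nn_average :: "'a::euclidean_space set \<Rightarrow> ('a \<Rightarrow> ennreal) \<Rightarrow> ennreal" where
  "nn_average A f = (\<integral>\<^sup>+x\<in>A. f x \<partial>lebesgue) / emeasure lebesgue A"

definition Lq :: "real \<Rightarrow> 'a::euclidean_space set \<Rightarrow> ('a \<Rightarrow> 'b::euclidean_space) set" where
  "Lq q A = {u. u \<in> borel_measurable (lebesgue_on A) \<and>
               (\<integral>\<^sup>+x\<in>A. ennreal (norm (u x) powr q) \<partial>lebesgue) < \<infinity>}"

definition frac_sobolev :: "real \<Rightarrow> real \<Rightarrow> 'a::euclidean_space set \<Rightarrow> ('a \<Rightarrow> 'b::euclidean_space) set" where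
  "frac_sobolev r q A = {u \<in> Lq q A.
     (\<integral>\<^sup>+x\<in>A. (\<integral>\<^sup>+y\<in>A. ennreal (norm (u x - u y) powr q / norm (x - y) powr (real DIM('a) + r * q))
        \<partial>lebesgue) \<partial>lebesgue) < \<infinity>}"

definition frac_sobolev_loc :: "real \<Rightarrow> real \<Rightarrow> 'a::euclidean_space set \<Rightarrow> ('a \<Rightarrow> 'b::euclidean_space) set" where
  "frac_sobolev_loc r q \<Omega> =
     {u. \<forall>\<Omega>\<^sub>0. open \<Omega>\<^sub>0 \<and> compact (closure \<Omega>\<^sub>0) \<and> closure \<Omega>\<^sub>0 \<subseteq> \<Omega> \<longrightarrow> u \<in> frac_sobolev r q \<Omega>\<^sub>0}"

text \<open>
  The set \<open>\<S>'\<^sub>u\<close>.  Only the values of \<open>u\<close> on \<open>\<Omega>\<close> matter, since small balls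
  around a point of the open set \<open>\<Omega>\<close> lie in \<open>\<Omega>\<close>.
\<close>
definition approx_singular_set :: "'a::euclidean_space set \<Rightarrow> ('a \<Rightarrow> 'b::euclidean_space) \<Rightarrow> 'a set" where
  "approx_singular_set \<Omega> u =
     {x \<in> \<Omega>. \<not> ((\<lambda>\<rho>. INF c. nn_average (ball x \<rho>) (\<lambda>y. ennreal (norm (u y - c)))) \<longlongrightarrow> 0) (at_right 0)}"

end

theory Submission
  imports Defs
begin

text \<open>
  Write \<open>s = N - r q\<close>.  On a ball \<open>B\<close> of radius \<open>\<rho>\<close>, the double average of \<open>|u(z) - u(y)|\<^sup>q\<close> is at most
  a constant times \<open>\<rho>\<^sup>-\<^sup>s\<close> times the integral over \<open>B \<times> B\<close> of the Gagliardo kernel \<open>k\<close>.  If it fails to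
  tend to 0 at the points of \<open>E\<close>, then arbitrarily small balls around these points satisfy
  \<open>t \<rho>\<^sup>s \<le> \<integral>\<integral>\<^bsub>B \<times> B\<^esub> k\<close>, and Vitali's covering lemma bounds the premeasure of \<open>E\<close> at scale \<open>10 \<delta>\<close> by a
  constant times the integral of \<open>k\<close> over the strip \<open>|z - y| < 2 \<delta>\<close> around the diagonal.  This tends
  to 0 with \<open>\<delta>\<close> because \<open>k\<close> is integrable.  Restricting to the strip, instead of arguing with Lebesgue
  points, treats \<open>s = 0\<close> and \<open>s > 0\<close> alike.  The remaining limits follow from the double average by
  Jensen's inequality up to a constant.
\<close>

section \<open>Null sets of the Hausdorff measure\<close>

lemma hausdorff_measure_eq_0_iff:
  "hausdorff_measure s A = 0 \<longleftrightarrow> (\<forall>\<delta>>0. hausdorff_premeasure s \<delta> A = 0)"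
  unfolding hausdorff_measure_def by (auto simp: SUP_eq_iff bot_ennreal[symmetric] simp del: bot_ennreal)

lemma hausdorff_premeasure_mono: "A \<subseteq> B \<Longrightarrow> hausdorff_premeasure s \<delta> A \<le> hausdorff_premeasure s \<delta> B"
  unfolding hausdorff_premeasure_def by (rule INF_superset_mono) auto

lemma hausdorff_premeasure_antimono:
  assumes "\<delta> \<le> \<delta>'"
  shows "hausdorff_premeasure s \<delta>' A \<le> hausdorff_premeasure s \<delta> A"
  unfolding hausdorff_premeasure_def by (rule INF_superset_mono) (auto intro: order_trans[OF _ \<open>\<delta> \<le> \<delta>'\<close>])

lemma hausdorff_null_subset: "hausdorff_measure s B = 0 \<Longrightarrow> A \<subseteq> B \<Longrightarrow> hausdorff_measure s A = 0"
  unfolding hausdorff_measure_eq_0_iff using hausdorff_premeasure_mono[of A B s] by (metis le_zero_eq)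

text \<open>The definition admits only covers indexed by the natural numbers. Any countable cover is
  transported along \<open>to_nat_on\<close> and padded with empty sets, whose size is 0 for every
  \<open>s\<close>, so the sum does not change.\<close>

lemma hausdorff_premeasure_le:
  assumes I: "countable I" and cov: "A \<subseteq> (\<Union>i\<in>I. C i)" and bdd: "\<And>i. i \<in> I \<Longrightarrow> bounded (C i)"
    and diam: "\<And>i. i \<in> I \<Longrightarrow> diameter (C i) \<le> \<delta>" and "0 \<le> \<delta>"
  shows "hausdorff_premeasure s \<delta> A \<le> (\<integral>\<^sup>+i. hausdorff_size s (C i) \<partial>count_space I)"
proof -
  define f where "f = to_nat_on I"
  have inj: "inj_on f I" unfolding f_def using I by (rule inj_on_to_nat_on)
  define C' where "C' n = (if n \<in> f ` I then C (the_inv_into I f n) else {})" for n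
  have C'f: "C' (f i) = C i" if "i \<in> I" for i
    using that inj by (auto simp: C'_def the_inv_into_f_f)
  have C'0: "C' n = {}" if "n \<notin> f ` I" for n using that by (simp add: C'_def)
  have "A \<subseteq> (\<Union>n. C' n)" using cov C'f by fastforce
  moreover have "bounded (C' n) \<and> diameter (C' n) \<le> \<delta>" for n
  proof (cases "n \<in> f ` I")
    case True then show ?thesis using C'f bdd diam by auto
  next
    case False then show ?thesis using C'0 \<open>0 \<le> \<delta>\<close> by simp
  qed
  ultimately have "hausdorff_premeasure s \<delta> A \<le> (\<Sum>n. hausdorff_size s (C' n))"
    unfolding hausdorff_premeasure_def by (intro INF_lower) auto
  also have "\<dots> = (\<integral>\<^sup>+n. hausdorff_size s (C' n) \<partial>count_space UNIV)"
    by (simp add: nn_integral_count_space_nat)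
  also have "\<dots> = (\<integral>\<^sup>+n. hausdorff_size s (C' n) * indicator (f ` I) n \<partial>count_space UNIV)"
    by (intro nn_integral_cong) (auto simp: C'_def hausdorff_size_def indicator_def)
  also have "\<dots> = (\<integral>\<^sup>+n. hausdorff_size s (C' n) \<partial>count_space (f ` I))"
    by (simp add: nn_integral_count_space_indicator)
  also have "\<dots> = (\<integral>\<^sup>+i. hausdorff_size s (C' (f i)) \<partial>count_space I)"
    using inj by (intro nn_integral_bij_count_space[symmetric]) (simp add: bij_betw_def)
  also have "\<dots> = (\<integral>\<^sup>+i. hausdorff_size s (C i) \<partial>count_space I)"
    by (intro nn_integral_cong) (simp add: C'f)
  finally show ?thesis .
qed

text \<open>Given \<open>e\<close>, the set \<open>A n\<close> is covered at cost below
  \<open>e / 2 ^ Suc n\<close>. All these covers together form one cover indexed by pairs of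
  naturals, and the costs add up to at most \<open>e\<close>.\<close>

lemma hausdorff_null_UN:
  fixes A :: "nat \<Rightarrow> 'a::metric_space set"
  assumes null: "\<And>n. hausdorff_measure s (A n) = 0"
  shows "hausdorff_measure s (\<Union>n. A n) = 0"
  unfolding hausdorff_measure_eq_0_iff
proof (intro allI impI)
  fix \<delta> :: real assume \<delta>: "\<delta> > 0"
  have "hausdorff_premeasure s \<delta> (\<Union>n. A n) \<le> 0 + ennreal e" if e: "e > 0" for e :: real
  proof -
    have "\<exists>C. A n \<subseteq> (\<Union>i. C i) \<and> (\<forall>i. bounded (C i) \<and> diameter (C i) \<le> \<delta>) \<and>
        (\<Sum>i. hausdorff_size s (C i)) < ennreal (e * (1/2)^Suc n)" for n
    proof -
      have "hausdorff_premeasure s \<delta> (A n) < ennreal (e * (1/2)^Suc n)"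
        using null[of n] \<delta> e by (simp add: hausdorff_measure_eq_0_iff)
      then show ?thesis unfolding hausdorff_premeasure_def INF_less_iff by auto
    qed
    then obtain C where C: "\<And>n. A n \<subseteq> (\<Union>i. C n i)" "\<And>n i. bounded (C n i)"
      "\<And>n i. diameter (C n i) \<le> \<delta>"
      "\<And>n. (\<Sum>i. hausdorff_size s (C n i)) < ennreal (e * (1/2)^Suc n)"
      by metis
    have "hausdorff_premeasure s \<delta> (\<Union>n. A n)
        \<le> (\<integral>\<^sup>+p. hausdorff_size s (C (fst p) (snd p)) \<partial>count_space (UNIV :: (nat \<times> nat) set))"
      using C(1) \<delta> by (intro hausdorff_premeasure_le) (auto simp: C(2,3), fastforce)
    also have "\<dots> = (\<integral>\<^sup>+n. \<integral>\<^sup>+i. hausdorff_size s (C n i) \<partial>count_space UNIV \<partial>count_space UNIV)"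
      by (subst nn_integral_fst_count_space[symmetric]) simp
    also have "\<dots> = (\<Sum>n. \<Sum>i. hausdorff_size s (C n i))"
      by (simp add: nn_integral_count_space_nat)
    also have "\<dots> \<le> (\<Sum>n. ennreal (e * (1/2)^Suc n))"
      by (intro suminf_le less_imp_le[OF C(4)] summableI)
    also have "\<dots> = ennreal (e * 1)"
      using e by (intro suminf_ennreal_eq sums_mult power_half_series) auto
    finally show ?thesis by simp
  qed
  then have "hausdorff_premeasure s \<delta> (\<Union>n. A n) \<le> 0"
    by (rule ennreal_le_epsilon)
  then show "hausdorff_premeasure s \<delta> (\<Union>n. A n) = 0" by simp
qed

lemma hausdorff_null_countable_Union:
  assumes "countable \<A>" and "\<And>A. A \<in> \<A> \<Longrightarrow> hausdorff_measure s A = 0"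
  shows "hausdorff_measure s (\<Union>\<A>) = 0"
proof (cases "\<A> = {}")
  \<comment> \<open>The empty family is separate because \<open>from_nat_into\<close> enumerates
    nonempty families only.\<close>
  case True
  have "hausdorff_premeasure s \<delta> ({} :: 'a set) = 0" if "0 < \<delta>" for \<delta>
    using hausdorff_premeasure_le[of "{}::nat set" "{}" "\<lambda>_. {}" \<delta> s] that
    by (simp add: nn_integral_count_space_finite)
  then show ?thesis by (simp add: True hausdorff_measure_eq_0_iff)
next
  case False
  then have "\<Union>\<A> = (\<Union>n. from_nat_into \<A> n)"
    using assms(1) by (simp add: range_from_nat_into)
  also have "hausdorff_measure s \<dots> = 0"
    by (intro hausdorff_null_UN assms(2) from_nat_into False)
  finally show ?thesis .
qed

section \<open>Covering bound by a measure\<close>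

text \<open>For \<open>s = 0\<close> the separate clause of the definition agrees with the general
  formula, since \<open>unit_ball_vol 0 = 1\<close> and \<open>r powr 0 = 1\<close> for positive
  \<open>r\<close>.\<close>

lemma hausdorff_size_ball:
  assumes "0 \<le> s" "0 < r"
  shows "hausdorff_size s (ball x r :: 'a::euclidean_space set) = ennreal (unit_ball_vol s * r powr s)"
  using assms by (simp add: hausdorff_size_def)

text \<open>Vitali's lemma selects countably many disjoint balls whose 5-fold enlargements cover
  \<open>E\<close>. These have diameter at most \<open>10 * \<delta>\<close>, and each has size at
  most a constant times the \<open>\<nu>\<close>-mass of the original ball. By disjointness the
  masses add up to at most the total mass.\<close>

lemma hausdorff_premeasure_le_emeasure:
  fixes \<nu> :: "'a::euclidean_space measure"
  assumes sets: "sets \<nu> = sets lebesgue" and t: "0 < t" and \<delta>: "0 < \<delta>" and s: "0 \<le> s"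
    and E: "\<And>x. x \<in> E \<Longrightarrow> \<exists>\<rho>. 0 < \<rho> \<and> \<rho> < \<delta> \<and> ennreal (t * \<rho> powr s) \<le> emeasure \<nu> (ball x \<rho>)"
  shows "hausdorff_premeasure s (10 * \<delta>) E \<le> ennreal (unit_ball_vol s * 5 powr s / t) * emeasure \<nu> UNIV"
proof -
  obtain \<rho> where \<rho>: "\<And>x. x \<in> E \<Longrightarrow> 0 < \<rho> x" "\<And>x. x \<in> E \<Longrightarrow> \<rho> x < \<delta>"
      "\<And>x. x \<in> E \<Longrightarrow> ennreal (t * \<rho> x powr s) \<le> emeasure \<nu> (ball x (\<rho> x))"
    using E by metis
  obtain C where C: "countable C" "C \<subseteq> E"
      "pairwise (\<lambda>i j. disjnt (cball i (\<rho> i)) (cball j (\<rho> j))) C"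
      "\<And>i. i \<in> E \<Longrightarrow> \<exists>j. j \<in> C \<and> \<not> disjnt (cball i (\<rho> i)) (cball j (\<rho> j)) \<and>
                        cball i (\<rho> i) \<subseteq> ball j (5 * \<rho> j)"
  proof (rule Vitali_covering_lemma_cballs_balls[of E \<rho> \<delta> "\<lambda>x. x"])
    show "0 < \<rho> i \<and> \<rho> i \<le> \<delta>" if "i \<in> E" for i using \<rho>(1,2)[OF that] by simp
  qed (rule that)
  have [simp]: "x \<in> C \<Longrightarrow> 0 < \<rho> x" for x using C(2) \<rho>(1) by auto
  have "E \<subseteq> (\<Union>j\<in>C. ball j (5 * \<rho> j))"
  proof
    fix i assume i: "i \<in> E"
    then have "i \<in> cball i (\<rho> i)" using \<rho>(1) by (simp add: less_imp_le)
    then show "i \<in> (\<Union>j\<in>C. ball j (5 * \<rho> j))" using C(4)[OF i] by blast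
  qed
  then have "hausdorff_premeasure s (10 * \<delta>) E \<le> (\<integral>\<^sup>+x. hausdorff_size s (ball x (5 * \<rho> x)) \<partial>count_space C)"
    using C(1,2) \<rho>(2) \<delta> by (intro hausdorff_premeasure_le) (auto intro: less_imp_le)
  also have "\<dots> \<le> (\<integral>\<^sup>+x. ennreal (unit_ball_vol s * 5 powr s / t) * emeasure \<nu> (ball x (\<rho> x)) \<partial>count_space C)"
  proof (intro nn_integral_mono)
    fix x assume "x \<in> space (count_space C)"
    then have x: "x \<in> C" "x \<in> E" using C(2) by auto
    then have "0 < \<rho> x" using \<rho> by simp
    \<comment> \<open>The constant is chosen so that
      \<open>unit_ball_vol s * (5 * \<rho> x) powr s\<close> splits off exactly the lower bound
      \<open>t * \<rho> x powr s\<close> of the mass.\<close>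
    then have "hausdorff_size s (ball x (5 * \<rho> x)) = ennreal (unit_ball_vol s * 5 powr s / t) * ennreal (t * \<rho> x powr s)"
      using s t by (subst ennreal_mult'[symmetric]) (auto simp: hausdorff_size_ball powr_mult)
    also have "\<dots> \<le> ennreal (unit_ball_vol s * 5 powr s / t) * emeasure \<nu> (ball x (\<rho> x))"
      by (intro mult_left_mono \<rho> x) simp
    finally show "hausdorff_size s (ball x (5 * \<rho> x)) \<le> \<dots>" .
  qed
  also have "\<dots> = ennreal (unit_ball_vol s * 5 powr s / t) * (\<integral>\<^sup>+x. emeasure \<nu> (ball x (\<rho> x)) \<partial>count_space C)"
    by (intro nn_integral_cmult) simp
  also have "(\<integral>\<^sup>+x. emeasure \<nu> (ball x (\<rho> x)) \<partial>count_space C) = emeasure \<nu> (\<Union>x\<in>C. ball x (\<rho> x))"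
  proof (rule emeasure_UN_countable[symmetric])
    show "disjoint_family_on (\<lambda>x. ball x (\<rho> x)) C"
      using C(3) ball_subset_cball unfolding disjoint_family_on_def pairwise_def disjnt_def by blast
  qed (use C sets in auto)
  also have "ennreal (unit_ball_vol s * 5 powr s / t) * emeasure \<nu> (\<Union>x\<in>C. ball x (\<rho> x))
      \<le> ennreal (unit_ball_vol s * 5 powr s / t) * emeasure \<nu> UNIV"
    by (intro mult_left_mono emeasure_mono) (auto simp: sets)
  finally show ?thesis .
qed

section \<open>Integrable kernels near the diagonal\<close>

text \<open>Completion keeps the measure of Borel sets, so the witnesses for \<open>lborel\<close>
  still serve. Sigma-finiteness is what Tonelli's theorem and the measurability of inner integrals
  over \<open>lebesgue\<close> require.\<close>

lemma sigma_finite_lebesgue: "sigma_finite_measure (lebesgue :: 'a::euclidean_space measure)"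
proof
  obtain A :: "'a set set" where A: "countable A" "A \<subseteq> sets lborel" "\<Union>A = space lborel"
      "\<forall>a\<in>A. emeasure lborel a \<noteq> \<infinity>"
    using lborel.sigma_finite_countable by metis
  have "a \<in> sets lebesgue \<and> emeasure lebesgue a \<noteq> \<infinity>" if "a \<in> A" for a
  proof -
    have "a \<in> sets lborel" using A(2) that by (rule subsetD)
    with A(4) that emeasure_completion[of a lborel] show ?thesis
      by (simp del: emeasure_completion)
  qed
  moreover have "\<Union>A = space lebesgue" using A(3) by (simp only: space_completion)
  ultimately show "\<exists>A::'a set set. countable A \<and> A \<subseteq> sets lebesgue \<and> \<Union>A = space lebesgue \<and>
      (\<forall>a\<in>A. emeasure lebesgue a \<noteq> \<infinity>)"
    using A(1) by blast
qed

interpretation lebesgue: sigma_finite_measure "lebesgue :: 'a::euclidean_space measure"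
  by (rule sigma_finite_lebesgue)

text \<open>The identity from \<open>lebesgue\<close> to \<open>borel\<close> is measurable because
  completion only adds measurable sets. With its counterpart for \<open>snd\<close>, this makes
  distances and kernels on the product accessible to the \<open>measurable\<close> method.\<close>

lemma fst_measurable_lebesgue [measurable]:
  "fst \<in> borel_measurable ((lebesgue :: 'a::euclidean_space measure) \<Otimes>\<^sub>M M)"
  by (rule measurable_compose[OF measurable_fst]) (simp add: measurable_completion)

lemma snd_measurable_lebesgue [measurable]:
  "snd \<in> borel_measurable (M \<Otimes>\<^sub>M (lebesgue :: 'a::euclidean_space measure))"
  by (rule measurable_compose[OF measurable_snd]) (simp add: measurable_completion)

text \<open>At points of the set, radii below any \<open>d n\<close> satisfy the lower bound. The
  covering bound thus applies at every scale \<open>10 * d n\<close>, with a measure whose total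
  mass tends to 0.\<close>

lemma hausdorff_null_kernel:
  fixes k :: "'a::euclidean_space \<times> 'a \<Rightarrow> ennreal"
  assumes k[measurable]: "k \<in> borel_measurable (lebesgue \<Otimes>\<^sub>M lebesgue)"
    and fin: "(\<integral>\<^sup>+z. \<integral>\<^sup>+y. k (z, y) \<partial>lebesgue \<partial>lebesgue) < \<infinity>"
    and diag: "\<And>x. k (x, x) = 0" and t: "0 < t" and s: "0 \<le> s"
  shows "hausdorff_measure s {x. \<exists>\<^sub>F \<rho> in at_right 0.
    ennreal (t * \<rho> powr s) \<le> (\<integral>\<^sup>+z\<in>ball x \<rho>. (\<integral>\<^sup>+y\<in>ball x \<rho>. k (z, y) \<partial>lebesgue) \<partial>lebesgue)} = 0"
    (is "hausdorff_measure s ?E = 0")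
  unfolding hausdorff_measure_eq_0_iff
proof (intro allI impI)
  fix \<delta> :: real assume \<delta>: "0 < \<delta>"
  define d where "d n = 1 / Suc n" for n
  have d: "0 < d n" for n by (simp add: d_def)
  have d0: "d \<longlonglongrightarrow> 0" unfolding d_def by real_asymp
  define D where "D n = {p :: 'a \<times> 'a. dist (fst p) (snd p) < 2 * d n}" for n
  have [measurable]: "D n \<in> sets (lebesgue \<Otimes>\<^sub>M lebesgue)" for n
  proof -
    have "Measurable.pred (lebesgue \<Otimes>\<^sub>M lebesgue) (\<lambda>p :: 'a \<times> 'a. dist (fst p) (snd p) < 2 * d n)"
      by measurable
    then show ?thesis by (simp add: pred_def D_def space_pair_measure)
  qed
  \<comment> \<open>\<open>\<nu> n\<close> is the first marginal of \<open>k\<close> restricted to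
    the strip \<open>D n\<close>. It is a measure on the space itself, as the covering bound
    demands, and its total mass is the integral of \<open>k\<close> over the strip.\<close>
  define \<nu> where "\<nu> n = density lebesgue (\<lambda>z. \<integral>\<^sup>+y. k (z, y) * indicator (D n) (z, y) \<partial>lebesgue)" for n
  define c where "c = ennreal (unit_ball_vol s * 5 powr s / t)"
  have [measurable]: "(\<lambda>z. \<integral>\<^sup>+y. k (z, y) * indicator (D n) (z, y) \<partial>lebesgue) \<in> borel_measurable lebesgue" for n
    by measurable
  have \<nu>UNIV: "emeasure (\<nu> n) UNIV = (\<integral>\<^sup>+p. k p * indicator (D n) p \<partial>(lebesgue \<Otimes>\<^sub>M lebesgue))" for n
    unfolding \<nu>_def by (subst emeasure_density) (auto simp: lebesgue.nn_integral_fst[symmetric])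
  have le: "hausdorff_premeasure s (10 * d n) ?E \<le> c * emeasure (\<nu> n) UNIV" for n
    unfolding c_def
  proof (rule hausdorff_premeasure_le_emeasure[OF _ t d s])
    fix x assume "x \<in> ?E"
    then have "\<exists>\<^sub>F \<rho> in at_right 0. ennreal (t * \<rho> powr s) \<le> (\<integral>\<^sup>+z\<in>ball x \<rho>. (\<integral>\<^sup>+y\<in>ball x \<rho>. k (z, y) \<partial>lebesgue) \<partial>lebesgue)"
      by simp
    moreover have "\<forall>\<^sub>F \<rho> in at_right 0. 0 < \<rho> \<and> \<rho> < d n"
      using d[of n] eventually_at_right_less[of 0] eventually_at_right_real[of 0 "d n"] by (auto elim: eventually_mono)
    ultimately have "\<exists>\<^sub>F \<rho> in at_right 0. (0 < \<rho> \<and> \<rho> < d n) \<and>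
       ennreal (t * \<rho> powr s) \<le> (\<integral>\<^sup>+z\<in>ball x \<rho>. (\<integral>\<^sup>+y\<in>ball x \<rho>. k (z, y) \<partial>lebesgue) \<partial>lebesgue)"
      by (rule frequently_eventually_conj)
    then obtain \<rho> where \<rho>: "0 < \<rho>" "\<rho> < d n"
      "ennreal (t * \<rho> powr s) \<le> (\<integral>\<^sup>+z\<in>ball x \<rho>. (\<integral>\<^sup>+y\<in>ball x \<rho>. k (z, y) \<partial>lebesgue) \<partial>lebesgue)"
      by (auto dest: frequently_ex)
    have "(\<integral>\<^sup>+z\<in>ball x \<rho>. (\<integral>\<^sup>+y\<in>ball x \<rho>. k (z, y) \<partial>lebesgue) \<partial>lebesgue)
        \<le> (\<integral>\<^sup>+z\<in>ball x \<rho>. (\<integral>\<^sup>+y. k (z, y) * indicator (D n) (z, y) \<partial>lebesgue) \<partial>lebesgue)"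
    proof (rule nn_integral_mono)
      fix z :: 'a
      have "(\<integral>\<^sup>+y\<in>ball x \<rho>. k (z, y) \<partial>lebesgue) \<le> (\<integral>\<^sup>+y. k (z, y) * indicator (D n) (z, y) \<partial>lebesgue)"
        if z: "z \<in> ball x \<rho>"
      proof (rule nn_integral_mono)
        fix y
        \<comment> \<open>Two points of a ball of radius less than \<open>d n\<close> are less than
          \<open>2 * d n\<close> apart, so the product of the ball with itself lies in the
          strip.\<close>
        have "(z, y) \<in> D n" if "y \<in> ball x \<rho>"
          using that z \<rho>(2) dist_triangle3[of z y x] by (auto simp: D_def)
        then show "k (z, y) * indicator (ball x \<rho>) y \<le> k (z, y) * indicator (D n) (z, y)"
          by (auto simp: indicator_def)
      qed
      then show "(\<integral>\<^sup>+y\<in>ball x \<rho>. k (z, y) \<partial>lebesgue) * indicator (ball x \<rho>) z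
         \<le> (\<integral>\<^sup>+y. k (z, y) * indicator (D n) (z, y) \<partial>lebesgue) * indicator (ball x \<rho>) z"
        by (auto simp: indicator_def)
    qed
    also have "\<dots> = emeasure (\<nu> n) (ball x \<rho>)"
      unfolding \<nu>_def by (subst emeasure_density) auto
    finally show "\<exists>\<rho>>0. \<rho> < d n \<and> ennreal (t * \<rho> powr s) \<le> emeasure (\<nu> n) (ball x \<rho>)"
      using \<rho> by (auto intro: order_trans)
  qed (simp add: \<nu>_def)
  have "(\<lambda>n. \<integral>\<^sup>+p. k p * indicator (D n) p \<partial>(lebesgue \<Otimes>\<^sub>M lebesgue)) \<longlonglongrightarrow> (\<integral>\<^sup>+p. 0 \<partial>((lebesgue :: 'a measure) \<Otimes>\<^sub>M (lebesgue :: 'a measure)))"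
  proof (rule nn_integral_dominated_convergence[where w = k])
    show "(\<integral>\<^sup>+ p. k p \<partial>(lebesgue \<Otimes>\<^sub>M lebesgue)) < \<infinity>"
      using fin by (simp add: lebesgue.nn_integral_fst[symmetric])
    show "AE p in lebesgue \<Otimes>\<^sub>M lebesgue. (\<lambda>n. k p * indicator (D n) p) \<longlonglongrightarrow> 0"
    proof (rule AE_I2)
      fix p :: "'a \<times> 'a"
      show "(\<lambda>n. k p * indicator (D n) p) \<longlonglongrightarrow> 0"
      \<comment> \<open>The strips shrink to the diagonal. There \<open>k\<close> vanishes by
        \<open>diag\<close>, and any other point leaves \<open>D n\<close> eventually.\<close>
      proof (cases "fst p = snd p")
        case True
        then have "k p = 0" using diag by (metis prod.collapse)
        then show ?thesis by simp
      next
        case False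
        then have "\<forall>\<^sub>F n in sequentially. d n < dist (fst p) (snd p) / 2"
          by (intro order_tendstoD[OF d0]) simp
        then have "\<forall>\<^sub>F n in sequentially. k p * indicator (D n) p = 0"
          by eventually_elim (simp add: D_def)
        then show ?thesis by (rule tendsto_eventually)
      qed
    qed
  qed (auto simp: indicator_def)
  then have "(\<lambda>n. emeasure (\<nu> n) UNIV) \<longlonglongrightarrow> 0"
    by (simp add: \<nu>UNIV)
  then have lim: "(\<lambda>n. c * emeasure (\<nu> n) UNIV) \<longlonglongrightarrow> c * 0"
    by (rule ennreal_tendsto_cmult[rotated]) (simp add: c_def)
  \<comment> \<open>Once \<open>10 * d n\<close> is below \<open>\<delta>\<close>, the bound at the
    finer scale also bounds the premeasure at the fixed scale \<open>\<delta>\<close>.\<close>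
  have "\<forall>\<^sub>F n in sequentially. d n < \<delta> / 10"
    using \<delta> by (intro order_tendstoD[OF d0]) simp
  then have "\<forall>\<^sub>F n in sequentially. hausdorff_premeasure s \<delta> ?E \<le> c * emeasure (\<nu> n) UNIV"
  proof eventually_elim
    case (elim n)
    have "hausdorff_premeasure s \<delta> ?E \<le> hausdorff_premeasure s (10 * d n) ?E"
      using elim by (intro hausdorff_premeasure_antimono) simp
    also note le
    finally show ?case .
  qed
  then have "hausdorff_premeasure s \<delta> ?E \<le> c * 0"
    by (intro tendsto_lowerbound[OF lim]) auto
  then show "hausdorff_premeasure s \<delta> ?E = 0" by simp
qed

section \<open>Averages and inequalities of Jensen type\<close>

lemma nn_average_eq:
  assumes "emeasure lebesgue B = ennreal m" "0 < m"
  shows "nn_average B f = ennreal (1 / m) * (\<integral>\<^sup>+x\<in>B. f x \<partial>lebesgue)"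
  using assms unfolding nn_average_def divide_ennreal_def
  by (simp add: inverse_ennreal inverse_eq_divide mult.commute)

lemma nn_average_mono:
  assumes "\<And>x. x \<in> B \<Longrightarrow> f x \<le> g x"
  shows "nn_average B f \<le> nn_average B g"
  unfolding nn_average_def
  by (intro divide_right_mono_ennreal nn_integral_mono) (auto simp: indicator_def assms)

lemma nn_average_cong:
  assumes "\<And>x. x \<in> B \<Longrightarrow> f x = g x"
  shows "nn_average B f = nn_average B g"
  unfolding nn_average_def
  by (intro arg_cong2[where f = "(/)"] nn_integral_cong refl) (auto simp: indicator_def assms)

lemma nn_average_cmult:
  assumes [measurable]: "f \<in> borel_measurable lebesgue" "B \<in> sets lebesgue"
  shows "nn_average B (\<lambda>x. c * f x) = c * nn_average B f"
  unfolding nn_average_def by (simp add: mult.assoc nn_integral_cmult ennreal_times_divide)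

lemma average_cong:
  assumes "\<And>x. x \<in> B \<Longrightarrow> f x = g x"
  shows "average B f = average B g"
  unfolding average_def set_lebesgue_integral_def
  by (intro arg_cong2[where f = "(/\<^sub>R)"] Bochner_Integration.integral_cong refl)
    (auto simp: indicator_def assms)

text \<open>For \<open>t > b\<close> the last summand equals
  \<open>t * (t / b) powr (q - 1)\<close>, which is at least \<open>t\<close>. With the height
  \<open>b\<close> free, this takes the place of Hoelder's inequality in comparing first powers with
  \<open>q\<close>-th powers.\<close>

lemma le_add_powr:
  fixes t b q :: real
  assumes "0 \<le> t" "0 < b" "1 \<le> q"
  shows "t \<le> b + b powr (1 - q) * t powr q"
proof (cases "t \<le> b")
  case True
  then show ?thesis by (simp add: add_increasing2)
next
  case False
  then have "b powr (q - 1) \<le> t powr (q - 1)" using assms by (intro powr_mono2) auto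
  then have "1 \<le> b powr (1 - q) * t powr (q - 1)"
    using assms mult_left_mono[of "b powr (q - 1)" "t powr (q - 1)" "b powr (1 - q)"]
    by (simp flip: powr_add)
  then have "t * 1 \<le> t * (b powr (1 - q) * t powr (q - 1))"
    using assms(1) by (rule mult_left_mono)
  also have "\<dots> = b powr (1 - q) * t powr q"
    using False assms powr_add[of t 1 "q - 1"] by simp
  finally show ?thesis using assms by simp
qed

lemma nn_integral_le_add_powr:
  assumes [measurable]: "f \<in> borel_measurable lebesgue" "B \<in> sets lebesgue"
    and "\<And>x. 0 \<le> f x" "0 < b" "1 \<le> q"
  shows "(\<integral>\<^sup>+x\<in>B. ennreal (f x) \<partial>lebesgue)
    \<le> ennreal b * emeasure lebesgue B + ennreal (b powr (1 - q)) * (\<integral>\<^sup>+x\<in>B. ennreal (f x powr q) \<partial>lebesgue)"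
proof -
  have "(\<integral>\<^sup>+x\<in>B. ennreal (f x) \<partial>lebesgue)
      \<le> (\<integral>\<^sup>+x. ennreal b * indicator B x + ennreal (b powr (1 - q)) * (ennreal (f x powr q) * indicator B x) \<partial>lebesgue)"
  proof (rule nn_integral_mono)
    fix x
    have "ennreal (f x) \<le> ennreal (b + b powr (1 - q) * f x powr q)"
      using le_add_powr[OF assms(3-5)] by (rule ennreal_leI)
    then show "ennreal (f x) * indicator B x
        \<le> ennreal b * indicator B x + ennreal (b powr (1 - q)) * (ennreal (f x powr q) * indicator B x)"
      using assms(4) by (simp add: ennreal_plus ennreal_mult' split: split_indicator)
  qed
  also have "\<dots> = ennreal b * emeasure lebesgue B
      + ennreal (b powr (1 - q)) * (\<integral>\<^sup>+x\<in>B. ennreal (f x powr q) \<partial>lebesgue)"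
    by (simp add: nn_integral_add nn_integral_cmult)
  finally show ?thesis .
qed

text \<open>The height \<open>b\<close> can be taken small where the last average tends to 0, or as
  half of the quantity to be estimated where the first summand is to be absorbed.\<close>

lemma nn_average_le_add_powr:
  assumes [measurable]: "f \<in> borel_measurable lebesgue" and B: "B \<in> lmeasurable" "emeasure lebesgue B \<noteq> 0"
    and "\<And>x. 0 \<le> f x" "0 < b" "1 \<le> q"
  shows "nn_average B (\<lambda>x. ennreal (f x))
    \<le> ennreal b + ennreal (b powr (1 - q)) * nn_average B (\<lambda>x. ennreal (f x powr q))"
proof -
  have fin: "emeasure lebesgue B \<noteq> top" using B(1) by (auto simp: fmeasurable_def)
  have "nn_average B (\<lambda>x. ennreal (f x)) \<le> (ennreal b * emeasure lebesgue B
      + ennreal (b powr (1 - q)) * (\<integral>\<^sup>+x\<in>B. ennreal (f x powr q) \<partial>lebesgue)) / emeasure lebesgue B"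
    unfolding nn_average_def using assms by (intro divide_right_mono_ennreal nn_integral_le_add_powr) (auto simp: fmeasurable_def)
  also have "\<dots> = ennreal b + ennreal (b powr (1 - q)) * nn_average B (\<lambda>x. ennreal (f x powr q))"
    using fin B(2) by (simp add: add_divide_distrib_ennreal nn_average_def ennreal_times_divide mult_divide_eq_ennreal)
  finally show ?thesis .
qed

text \<open>Splitting at height 1 bounds the integral of the norm by the finite measure of
  \<open>B\<close> plus the integral of the \<open>q\<close>-th power.\<close>

lemma set_integrable_if_powr:
  fixes v :: "'a::euclidean_space \<Rightarrow> 'b::euclidean_space"
  assumes v[measurable]: "v \<in> borel_measurable lebesgue" and B: "B \<in> lmeasurable" and "1 \<le> q"
    and fin: "(\<integral>\<^sup>+x\<in>B. ennreal (norm (v x) powr q) \<partial>lebesgue) < \<infinity>"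
  shows "set_integrable lebesgue B v"
proof -
  have [measurable]: "B \<in> sets lebesgue" using B by (auto simp: fmeasurable_def)
  have "(\<integral>\<^sup>+x. ennreal (norm (indicator B x *\<^sub>R v x)) \<partial>lebesgue) = (\<integral>\<^sup>+x\<in>B. ennreal (norm (v x)) \<partial>lebesgue)"
    by (intro nn_integral_cong) (simp split: split_indicator)
  also have "\<dots> \<le> ennreal 1 * emeasure lebesgue B
      + ennreal (1 powr (1 - q)) * (\<integral>\<^sup>+x\<in>B. ennreal (norm (v x) powr q) \<partial>lebesgue)"
    using \<open>1 \<le> q\<close> by (intro nn_integral_le_add_powr) auto
  also have "\<dots> < \<infinity>"
    using fin B by (simp add: fmeasurable_def)
  finally show ?thesis
    unfolding set_integrable_def by (intro integrableI_bounded) auto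
qed

text \<open>A constant is its own average over \<open>B\<close>, so \<open>c - average B v\<close>
  is the average of \<open>c - v\<close>, and the norm passes inside the integral. Integrability
  makes \<open>average B v\<close> a genuine mean rather than the default value of the Bochner
  integral.\<close>

lemma norm_diff_average_le:
  fixes v :: "'a::euclidean_space \<Rightarrow> 'b::euclidean_space"
  assumes B: "B \<in> lmeasurable" "emeasure lebesgue B \<noteq> 0" and v: "set_integrable lebesgue B v"
  shows "ennreal (norm (c - average B v)) \<le> nn_average B (\<lambda>y. ennreal (norm (c - v y)))"
proof -
  define m where "m = measure lebesgue B"
  have m: "emeasure lebesgue B = ennreal m"
    unfolding m_def using B(1) by (intro emeasure_eq_ennreal_measure) (auto simp: fmeasurable_def)
  then have "0 < m" using B(2) by (metis ennreal_eq_0_iff not_le)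
  have c: "set_integrable lebesgue B (\<lambda>_. c)"
    using B(1) by (auto simp: set_integrable_def fmeasurable_def)
  have "integrable lebesgue (indicat_real B)"
    using B(1) by (intro integrable_real_indicator) (auto simp: fmeasurable_def)
  then have const: "(LINT y|lebesgue. indicat_real B y *\<^sub>R c) = m *\<^sub>R c"
    by (subst integral_scaleR_left) (auto simp: m_def)
  have "(LINT y:B|lebesgue. c - v y) = m *\<^sub>R c - (LINT y:B|lebesgue. v y)"
    using set_integral_diff(2)[OF c v] const by (simp add: set_lebesgue_integral_def)
  then have "c - average B v = (1 / m) *\<^sub>R (LINT y:B|lebesgue. c - v y)"
    using \<open>0 < m\<close> by (simp add: average_def m_def[symmetric] scaleR_diff_right divide_inverse)
  then have "ennreal (norm (c - average B v)) = ennreal (1 / m) * ennreal (norm (LINT y:B|lebesgue. c - v y))"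
    using \<open>0 < m\<close> by (simp add: ennreal_mult'[symmetric])
  also have "\<dots> \<le> ennreal (1 / m) * (\<integral>\<^sup>+y. ennreal (norm (indicator B y *\<^sub>R (c - v y))) \<partial>lebesgue)"
    unfolding set_lebesgue_integral_def using set_integral_diff(1)[OF c v]
    by (intro mult_left_mono integral_norm_bound_ennreal) (auto simp: set_integrable_def)
  also have "(\<integral>\<^sup>+y. ennreal (norm (indicator B y *\<^sub>R (c - v y))) \<partial>lebesgue)
      = (\<integral>\<^sup>+y\<in>B. ennreal (norm (c - v y)) \<partial>lebesgue)"
    by (intro nn_integral_cong) (simp split: split_indicator)
  finally show ?thesis
    by (simp add: nn_average_eq[OF m \<open>0 < m\<close>])
qed

text \<open>
  Jensen's inequality up to the factor \<open>2\<^sup>q\<close>: with \<open>a\<close> the left-hand norm, splitting at the height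
  \<open>a / 2\<close> lets the first summand of \<open>nn_average_le_add_powr\<close> be absorbed.
\<close>
lemma norm_diff_average_powr_le:
  fixes v :: "'a::euclidean_space \<Rightarrow> 'b::euclidean_space"
  assumes v[measurable]: "v \<in> borel_measurable lebesgue"
    and B: "B \<in> lmeasurable" "emeasure lebesgue B \<noteq> 0" and int: "set_integrable lebesgue B v" and q: "1 \<le> q"
  shows "ennreal (norm (c - average B v) powr q)
    \<le> ennreal (2 powr q) * nn_average B (\<lambda>y. ennreal (norm (c - v y) powr q))"
proof -
  define a where "a = norm (c - average B v)"
  define J where "J = nn_average B (\<lambda>y. ennreal (norm (c - v y) powr q))"
  have "ennreal (a powr q) \<le> ennreal (2 powr q) * J"
  \<comment> \<open>Outside these trivial cases \<open>a / 2\<close> is positive, hence an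
    admissible height, and \<open>J\<close> is a real number, so that \<open>a / 2\<close> can be
    subtracted from both sides.\<close>
  proof (cases "a = 0 \<or> J = top")
    case True
    then show ?thesis by (auto simp: ennreal_mult_top)
  next
    case False
    then have a: "0 < a" by (simp add: a_def)
    from False obtain j where j: "J = ennreal j" "0 \<le> j" by (cases J) auto
    have "ennreal a \<le> ennreal (a / 2) + ennreal ((a / 2) powr (1 - q)) * J"
      unfolding J_def using norm_diff_average_le[OF B int, of c] a q
      by (intro order_trans[OF _ nn_average_le_add_powr[OF _ B]]) (auto simp: a_def)
    also have "\<dots> = ennreal (a / 2 + (a / 2) powr (1 - q) * j)"
      using a j by (simp add: ennreal_plus ennreal_mult')
    finally have "a \<le> a / 2 + (a / 2) powr (1 - q) * j"
      using a j by (subst (asm) ennreal_le_iff) auto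
    then have "a / 2 \<le> (a / 2) powr (1 - q) * j" by simp
    then have "(a / 2) powr (q - 1) * (a / 2) \<le> (a / 2) powr (q - 1) * ((a / 2) powr (1 - q) * j)"
      by (rule mult_left_mono) simp
    also have "\<dots> = j" using a by (simp flip: mult.assoc powr_add)
    also have "(a / 2) powr (q - 1) * (a / 2) = (a / 2) powr q"
      using a powr_add[of "a / 2" "q - 1" 1] by simp
    finally have "a powr q \<le> 2 powr q * j"
      using a by (simp add: powr_divide field_simps)
    then show ?thesis using j by (simp add: ennreal_mult'[symmetric] ennreal_leI)
  qed
  then show ?thesis by (simp add: a_def J_def)
qed

section \<open>Mean oscillation on balls\<close>

definition mean_osc :: "real \<Rightarrow> ('a::euclidean_space \<Rightarrow> 'b::euclidean_space) \<Rightarrow> 'a set \<Rightarrow> ennreal" where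
  "mean_osc q u B = nn_average B (\<lambda>z. nn_average B (\<lambda>y. ennreal (norm (u z - u y) powr q)))"

text \<open>This is \<open>norm_diff_average_powr_le\<close> at \<open>c = v z\<close>, averaged
  over \<open>z\<close>.\<close>

lemma nn_average_diff_average_powr_le:
  fixes v :: "'a::euclidean_space \<Rightarrow> 'b::euclidean_space"
  assumes v[measurable]: "v \<in> borel_measurable lebesgue"
    and B: "B \<in> lmeasurable" "emeasure lebesgue B \<noteq> 0" and int: "set_integrable lebesgue B v" and q: "1 \<le> q"
  shows "nn_average B (\<lambda>z. ennreal (norm (v z - average B v) powr q)) \<le> ennreal (2 powr q) * mean_osc q v B"
proof -
  have [measurable]: "B \<in> sets lebesgue" using B by (auto simp: fmeasurable_def)
  have [measurable]: "(\<lambda>z. nn_average B (\<lambda>y. ennreal (norm (v z - v y) powr q))) \<in> borel_measurable lebesgue"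
    unfolding nn_average_def by measurable
  have "nn_average B (\<lambda>z. ennreal (norm (v z - average B v) powr q))
     \<le> nn_average B (\<lambda>z. ennreal (2 powr q) * nn_average B (\<lambda>y. ennreal (norm (v z - v y) powr q)))"
    using assms by (intro nn_average_mono norm_diff_average_powr_le)
  also have "\<dots> = ennreal (2 powr q) * mean_osc q v B"
    unfolding mean_osc_def by (intro nn_average_cmult) auto
  finally show ?thesis .
qed

text \<open>The first limit is squeezed by a multiple of \<open>mean_osc\<close>. For the second,
  the infimum is at most its value at the mean of \<open>v\<close>, and the first power there is
  compared with the \<open>q\<close>-th power by splitting at a small height.\<close>

lemma mean_osc_tendsto_imp:
  fixes v :: "'a::euclidean_space \<Rightarrow> 'b::euclidean_space"
  assumes v[measurable]: "v \<in> borel_measurable lebesgue" and q: "1 \<le> q"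
    and int: "\<forall>\<^sub>F \<rho> in at_right 0. set_integrable lebesgue (ball x \<rho>) v"
    and lim: "((\<lambda>\<rho>. mean_osc q v (ball x \<rho>)) \<longlongrightarrow> 0) (at_right 0)"
  shows "((\<lambda>\<rho>. nn_average (ball x \<rho>) (\<lambda>z. ennreal (norm (v z - average (ball x \<rho>) v) powr q))) \<longlongrightarrow> 0) (at_right 0)"
      (is "(?A \<longlongrightarrow> 0) _")
    and "((\<lambda>\<rho>. INF c. nn_average (ball x \<rho>) (\<lambda>y. ennreal (norm (v y - c)))) \<longlongrightarrow> 0) (at_right 0)"
      (is "(?I \<longlongrightarrow> 0) _")
proof -
  have ball: "ball x \<rho> \<in> lmeasurable" "0 < \<rho> \<Longrightarrow> emeasure lebesgue (ball x \<rho>) \<noteq> 0" for \<rho>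
    using unit_ball_vol_pos[of "real DIM('a)"] by (auto simp: emeasure_ball simp del: unit_ball_vol_pos)
  have pos: "\<forall>\<^sub>F \<rho> in at_right 0. (0::real) < \<rho>" by (rule eventually_at_right_less)
  have "((\<lambda>\<rho>. ennreal (2 powr q) * mean_osc q v (ball x \<rho>)) \<longlongrightarrow> ennreal (2 powr q) * 0) (at_right 0)"
    by (intro ennreal_tendsto_cmult lim) simp
  then have lim2: "((\<lambda>\<rho>. ennreal (2 powr q) * mean_osc q v (ball x \<rho>)) \<longlongrightarrow> 0) (at_right 0)" by simp
  show A: "(?A \<longlongrightarrow> 0) (at_right 0)"
  proof (rule tendsto_sandwich[OF _ _ tendsto_const lim2])
    show "\<forall>\<^sub>F \<rho> in at_right 0. ?A \<rho> \<le> ennreal (2 powr q) * mean_osc q v (ball x \<rho>)"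
      using int pos by eventually_elim (intro nn_average_diff_average_powr_le ball v q)
  qed simp
  show "(?I \<longlongrightarrow> 0) (at_right 0)"
  proof (rule order_tendstoI)
    fix e :: ennreal assume "0 < e"
    \<comment> \<open>As \<open>e\<close> may be infinite, a finite \<open>e'\<close> below it
      supplies the real height \<open>b\<close>. The bound then tends to \<open>b\<close>, which is
      strictly below \<open>e\<close>.\<close>
    then obtain e' where e': "0 < e'" "e' < e" using dense by blast
    then obtain b where b: "e' = ennreal b" "0 < b" by (cases e') auto
    have "((\<lambda>\<rho>. ennreal b + ennreal (b powr (1 - q)) * ?A \<rho>) \<longlongrightarrow> ennreal b + ennreal (b powr (1 - q)) * 0) (at_right 0)"
      by (intro tendsto_add tendsto_const ennreal_tendsto_cmult A) simp
    then have "\<forall>\<^sub>F \<rho> in at_right 0. ennreal b + ennreal (b powr (1 - q)) * ?A \<rho> < e"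
      using e' b by (auto dest: order_tendstoD(2))
    then show "\<forall>\<^sub>F \<rho> in at_right 0. ?I \<rho> < e"
      using pos
    proof eventually_elim
      case (elim \<rho>)
      have "?I \<rho> \<le> nn_average (ball x \<rho>) (\<lambda>y. ennreal (norm (v y - average (ball x \<rho>) v)))"
        by (rule INF_lower) simp
      also have "\<dots> \<le> ennreal b + ennreal (b powr (1 - q)) * ?A \<rho>"
        using elim b q by (intro nn_average_le_add_powr ball) auto
      also note elim(1)
      finally show ?case .
    qed
  qed simp
qed

text \<open>Points of the ball are less than \<open>2 * \<rho>\<close> apart, so the numerator is at
  most \<open>(2 * \<rho>) powr p\<close> times the kernel. The two averages divide by the squared
  volume of the ball, which gives the exponent \<open>p - 2 * DIM('a)\<close>. For
  \<open>p = N + r q\<close> it equals \<open>-(N - r q)\<close>.\<close>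

lemma mean_osc_ball_le:
  fixes v :: "'a::euclidean_space \<Rightarrow> 'b::euclidean_space"
  assumes v[measurable]: "v \<in> borel_measurable lebesgue" and \<rho>: "0 < \<rho>" and q: "1 \<le> q" and p: "0 \<le> p"
  shows "mean_osc q v (ball x \<rho>) \<le> ennreal (2 powr p / unit_ball_vol DIM('a) ^ 2 * \<rho> powr (p - 2 * DIM('a))) *
    (\<integral>\<^sup>+z\<in>ball x \<rho>. (\<integral>\<^sup>+y\<in>ball x \<rho>. ennreal (norm (v z - v y) powr q / norm (z - y) powr p) \<partial>lebesgue) \<partial>lebesgue)"
proof -
  define m where "m = unit_ball_vol DIM('a) * \<rho> powr DIM('a)"
  have m: "emeasure lebesgue (ball x \<rho>) = ennreal m" "0 < m"
    using \<rho> by (simp_all add: m_def emeasure_ball powr_realpow)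
  define k where "k z y = ennreal (norm (v z - v y) powr q / norm (z - y) powr p)" for z y
  have [measurable]: "case_prod k \<in> borel_measurable (lebesgue \<Otimes>\<^sub>M lebesgue)"
    unfolding k_def case_prod_beta by measurable
  have [measurable]: "ball x \<rho> \<in> sets lebesgue" by simp
  define K where "K z = (\<integral>\<^sup>+y\<in>ball x \<rho>. k z y \<partial>lebesgue)" for z
  have K[measurable]: "K \<in> borel_measurable lebesgue"
    unfolding K_def by measurable
  \<comment> \<open>\<open>c\<close> joins the kernel bound to the volume factor of the inner
    average; the outer average contributes the second \<open>1 / m\<close>.\<close>
  define c where "c = 1 / m * (2 * \<rho>) powr p"
  have c: "ennreal c = ennreal (1 / m) * ennreal ((2 * \<rho>) powr p)"
    unfolding c_def using m(2) by (intro ennreal_mult) auto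
  have "nn_average (ball x \<rho>) (\<lambda>y. ennreal (norm (v z - v y) powr q)) \<le> ennreal c * K z"
    if z: "z \<in> ball x \<rho>" for z
  proof -
    have "norm (v z - v y) powr q \<le> (2 * \<rho>) powr p * (norm (v z - v y) powr q / norm (z - y) powr p)"
      if y: "y \<in> ball x \<rho>" for y
    \<comment> \<open>For \<open>z = y\<close> both sides are 0, the left one because
      \<open>0 powr q = 0\<close>.\<close>
    proof (cases "z = y")
      case False
      have "norm (z - y) < 2 * \<rho>"
        using z y dist_triangle3[of z y x] by (simp add: dist_norm[of z y, symmetric])
      then have "norm (z - y) powr p \<le> (2 * \<rho>) powr p" using p by (intro powr_mono2) auto
      then have "norm (v z - v y) powr q * norm (z - y) powr p \<le> norm (v z - v y) powr q * (2 * \<rho>) powr p"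
        by (rule mult_left_mono) simp
      then show ?thesis using False by (simp add: field_simps)
    qed (use q in simp)
    then have "nn_average (ball x \<rho>) (\<lambda>y. ennreal (norm (v z - v y) powr q))
        \<le> nn_average (ball x \<rho>) (\<lambda>y. ennreal ((2 * \<rho>) powr p) * k z y)"
      by (intro nn_average_mono) (simp add: k_def ennreal_mult'[symmetric] ennreal_leI)
    also have "\<dots> = ennreal ((2 * \<rho>) powr p) * nn_average (ball x \<rho>) (k z)"
      by (rule nn_average_cmult) measurable
    also have "\<dots> = ennreal c * K z"
      unfolding c nn_average_eq[OF m] K_def by (simp only: mult_ac)
    finally show ?thesis .
  qed
  then have "mean_osc q v (ball x \<rho>) \<le> nn_average (ball x \<rho>) (\<lambda>z. ennreal c * K z)"
    unfolding mean_osc_def by (rule nn_average_mono)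
  also have "\<dots> = ennreal c * nn_average (ball x \<rho>) K"
    by (rule nn_average_cmult) measurable
  also have "\<dots> = ennreal (1 / m * (1 / m) * (2 * \<rho>) powr p) * (\<integral>\<^sup>+z\<in>ball x \<rho>. K z \<partial>lebesgue)"
  proof -
    have "ennreal (1 / m * (1 / m) * (2 * \<rho>) powr p) = ennreal (1 / m) * ennreal c"
      unfolding c_def mult.assoc using m(2) by (intro ennreal_mult) auto
    then show ?thesis unfolding nn_average_eq[OF m] by (simp only: mult_ac)
  qed
  also have "1 / m * (1 / m) * (2 * \<rho>) powr p
      = 2 powr p / unit_ball_vol DIM('a) ^ 2 * \<rho> powr (p - 2 * DIM('a))"
  proof -
    have "\<rho> powr (2 * DIM('a)) = \<rho> powr DIM('a) * \<rho> powr DIM('a)" by (simp flip: powr_add)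
    then show ?thesis using \<rho> by (simp add: m_def powr_mult powr_diff power2_eq_square field_simps)
  qed
  finally show ?thesis by (simp add: K_def k_def)
qed

lemma mean_osc_cong: "(\<And>x. x \<in> B \<Longrightarrow> u x = v x) \<Longrightarrow> mean_osc q u B = mean_osc q v B"
  unfolding mean_osc_def by (intro nn_average_cong) auto

lemma eventually_at_right_ball_subset:
  assumes "open S" "x \<in> S"
  shows "\<forall>\<^sub>F \<rho> in at_right (0::real). ball x \<rho> \<subseteq> S"
proof -
  obtain e where e: "0 < e" "ball x e \<subseteq> S" using assms by (auto simp: open_contains_ball)
  then show ?thesis
    by (auto intro!: eventually_at_rightI[of 0 e] dest: subset_ball[OF less_imp_le])
qed

text \<open>\<open>u\<close> is known to be measurable on \<open>S\<close> only. Its extension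
  \<open>v\<close> by 0 is measurable on the whole space, and all averages of \<open>u\<close> and
  \<open>v\<close> agree on the small balls around \<open>x\<close>, which lie in
  \<open>S\<close>.\<close>

lemma mean_osc_tendsto_imp_Lq:
  fixes u :: "'a::euclidean_space \<Rightarrow> 'b::euclidean_space"
  assumes S: "open S" "x \<in> S" and u: "u \<in> Lq q S" and q: "1 \<le> q"
    and lim: "((\<lambda>\<rho>. mean_osc q u (ball x \<rho>)) \<longlongrightarrow> 0) (at_right 0)"
  shows "((\<lambda>\<rho>. nn_average (ball x \<rho>) (\<lambda>z. ennreal (norm (u z - average (ball x \<rho>) u) powr q))) \<longlongrightarrow> 0) (at_right 0)"
    and "((\<lambda>\<rho>. INF c. nn_average (ball x \<rho>) (\<lambda>y. ennreal (norm (u y - c)))) \<longlongrightarrow> 0) (at_right 0)"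
proof -
  define v where "v x = (if x \<in> S then u x else 0)" for x
  have Sm: "S \<in> sets lebesgue" using S by auto
  have v: "v \<in> borel_measurable lebesgue"
    using u Sm unfolding v_def Lq_def by (intro borel_measurable_if_I) auto
  have sub: "\<forall>\<^sub>F \<rho> in at_right 0. ball x \<rho> \<subseteq> S"
    by (rule eventually_at_right_ball_subset[OF S])
  have "\<forall>\<^sub>F \<rho> in at_right 0. mean_osc q u (ball x \<rho>) = mean_osc q v (ball x \<rho>)"
    using sub by eventually_elim (intro mean_osc_cong, auto simp: v_def)
  then have lim': "((\<lambda>\<rho>. mean_osc q v (ball x \<rho>)) \<longlongrightarrow> 0) (at_right 0)"
    using lim by (simp cong: tendsto_cong)
  have int: "\<forall>\<^sub>F \<rho> in at_right 0. set_integrable lebesgue (ball x \<rho>) v"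
    using sub
  proof eventually_elim
    case (elim \<rho>)
    have "(\<integral>\<^sup>+y\<in>ball x \<rho>. ennreal (norm (v y) powr q) \<partial>lebesgue) \<le> (\<integral>\<^sup>+y\<in>S. ennreal (norm (u y) powr q) \<partial>lebesgue)"
      using elim by (intro nn_integral_mono) (auto simp: v_def split: split_indicator)
    also have "\<dots> < \<infinity>" using u by (simp add: Lq_def)
    finally show ?case by (intro set_integrable_if_powr[OF v _ q]) auto
  qed
  note lims = mean_osc_tendsto_imp[OF v q int lim']
  have "\<forall>\<^sub>F \<rho> in at_right 0. nn_average (ball x \<rho>) (\<lambda>z. ennreal (norm (v z - average (ball x \<rho>) v) powr q))
     = nn_average (ball x \<rho>) (\<lambda>z. ennreal (norm (u z - average (ball x \<rho>) u) powr q))"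
    using sub
  proof eventually_elim
    case (elim \<rho>)
    have "average (ball x \<rho>) v = average (ball x \<rho>) u"
      using elim by (intro average_cong) (auto simp: v_def)
    then show ?case using elim by (intro nn_average_cong) (auto simp: v_def)
  qed
  from tendsto_cong[OF this] lims(1)
  show "((\<lambda>\<rho>. nn_average (ball x \<rho>) (\<lambda>z. ennreal (norm (u z - average (ball x \<rho>) u) powr q))) \<longlongrightarrow> 0) (at_right 0)"
    by simp
  have "\<forall>\<^sub>F \<rho> in at_right 0. (INF c. nn_average (ball x \<rho>) (\<lambda>y. ennreal (norm (v y - c))))
     = (INF c. nn_average (ball x \<rho>) (\<lambda>y. ennreal (norm (u y - c))))"
    using sub
  proof eventually_elim
    case (elim \<rho>)
    then show ?case by (intro INF_cong refl nn_average_cong) (auto simp: v_def)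
  qed
  from tendsto_cong[OF this] lims(2)
  show "((\<lambda>\<rho>. INF c. nn_average (ball x \<rho>) (\<lambda>y. ennreal (norm (u y - c)))) \<longlongrightarrow> 0) (at_right 0)"
    by simp
qed

section \<open>Exceptional sets of fractional Sobolev functions\<close>

text \<open>Where the oscillation fails to tend to 0, it stays above some \<open>1 / Suc n\<close>
  along arbitrarily small radii. The estimate on balls turns this into a lower bound for the kernel
  integral, so countably many sets as in \<open>hausdorff_null_kernel\<close> cover the exceptional
  points.\<close>

lemma hausdorff_null_mean_osc:
  fixes u :: "'a::euclidean_space \<Rightarrow> 'b::euclidean_space" and q r :: real
  assumes S: "open S" and u: "u \<in> frac_sobolev r q S" and q: "1 \<le> q" and r: "0 < r" and rq: "r * q \<le> real DIM('a)"
  shows "hausdorff_measure (real DIM('a) - r * q)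
    {x \<in> S. \<not> ((\<lambda>\<rho>. mean_osc q u (ball x \<rho>)) \<longlongrightarrow> 0) (at_right 0)} = 0"
proof -
  define v where "v x = (if x \<in> S then u x else 0)" for x
  define p where "p = real DIM('a) + r * q"
  define C where "C = 2 powr p / unit_ball_vol DIM('a) ^ 2"
  define s where "s = real DIM('a) - r * q"
  have p: "0 \<le> p" using q r by (simp add: p_def)
  have C: "0 < C"
    unfolding C_def by (intro divide_pos_pos zero_less_power unit_ball_vol_pos) auto
  have s: "0 \<le> s" using rq by (simp add: s_def)
  have Sm[measurable]: "S \<in> sets lebesgue" using S by auto
  have v[measurable]: "v \<in> borel_measurable lebesgue"
    using u Sm unfolding v_def frac_sobolev_def Lq_def by (intro borel_measurable_if_I) auto
  \<comment> \<open>The two indicators turn the integral over the product of \<open>S\<close> with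
    itself into one over the whole product space, the form that \<open>hausdorff_null_kernel\<close>
    takes.\<close>
  define k where "k w = ennreal (norm (v (fst w) - v (snd w)) powr q / norm (fst w - snd w) powr p) *
    indicator S (snd w) * indicator S (fst w)" for w
  have k[measurable]: "k \<in> borel_measurable (lebesgue \<Otimes>\<^sub>M lebesgue)"
    unfolding k_def by measurable
  have "(\<integral>\<^sup>+z. \<integral>\<^sup>+y. k (z, y) \<partial>lebesgue \<partial>lebesgue) = (\<integral>\<^sup>+z\<in>S. (\<integral>\<^sup>+y\<in>S.
      ennreal (norm (u z - u y) powr q / norm (z - y) powr (real DIM('a) + r * q)) \<partial>lebesgue) \<partial>lebesgue)"
  proof (intro nn_integral_cong)
    fix z
    show "(\<integral>\<^sup>+y. k (z, y) \<partial>lebesgue) = (\<integral>\<^sup>+y\<in>S. ennreal (norm (u z - u y) powr q /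
        norm (z - y) powr (real DIM('a) + r * q)) \<partial>lebesgue) * indicator S z"
    proof (cases "z \<in> S")
      case True
      then have "(\<integral>\<^sup>+y. k (z, y) \<partial>lebesgue) = (\<integral>\<^sup>+y\<in>S. ennreal (norm (u z - u y) powr q /
        norm (z - y) powr (real DIM('a) + r * q)) \<partial>lebesgue)"
        by (intro nn_integral_cong) (auto simp: k_def v_def p_def split: split_indicator)
      then show ?thesis using True by simp
    qed (simp add: k_def)
  qed
  then have fin: "(\<integral>\<^sup>+z. \<integral>\<^sup>+y. k (z, y) \<partial>lebesgue \<partial>lebesgue) < \<infinity>"
    using u by (simp add: frac_sobolev_def)
  define I where "I x \<rho> = (\<integral>\<^sup>+z\<in>ball x \<rho>. (\<integral>\<^sup>+y\<in>ball x \<rho>. k (z, y) \<partial>lebesgue) \<partial>lebesgue)" for x \<rho>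
  have osc: "mean_osc q u (ball x \<rho>) \<le> ennreal (C * \<rho> powr - s) * I x \<rho>"
    if "0 < \<rho>" "ball x \<rho> \<subseteq> S" for x \<rho>
  proof -
    have "mean_osc q u (ball x \<rho>) = mean_osc q v (ball x \<rho>)"
      using that by (intro mean_osc_cong) (auto simp: v_def)
    also have "\<dots> \<le> ennreal (C * \<rho> powr (p - 2 * DIM('a))) *
      (\<integral>\<^sup>+z\<in>ball x \<rho>. (\<integral>\<^sup>+y\<in>ball x \<rho>. ennreal (norm (v z - v y) powr q / norm (z - y) powr p) \<partial>lebesgue) \<partial>lebesgue)"
      unfolding C_def using that p q by (intro mean_osc_ball_le v)
    also have "(\<integral>\<^sup>+z\<in>ball x \<rho>. (\<integral>\<^sup>+y\<in>ball x \<rho>. ennreal (norm (v z - v y) powr q / norm (z - y) powr p) \<partial>lebesgue) \<partial>lebesgue) = I x \<rho>"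
      unfolding I_def
    proof (intro nn_integral_cong)
      fix z
      have "(\<integral>\<^sup>+y\<in>ball x \<rho>. ennreal (norm (v z - v y) powr q / norm (z - y) powr p) \<partial>lebesgue)
          = (\<integral>\<^sup>+y\<in>ball x \<rho>. k (z, y) \<partial>lebesgue)" if "z \<in> ball x \<rho>"
        using that \<open>ball x \<rho> \<subseteq> S\<close> by (intro nn_integral_cong) (auto simp: k_def split: split_indicator)
      then show "(\<integral>\<^sup>+y\<in>ball x \<rho>. ennreal (norm (v z - v y) powr q / norm (z - y) powr p) \<partial>lebesgue) * indicator (ball x \<rho>) z
          = (\<integral>\<^sup>+y\<in>ball x \<rho>. k (z, y) \<partial>lebesgue) * indicator (ball x \<rho>) z"
        by (auto split: split_indicator)
    qed
    also have "p - 2 * DIM('a) = - s" by (simp add: p_def s_def)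
    finally show ?thesis .
  qed
  \<comment> \<open>The threshold is such that multiplying by the factor
    \<open>C * \<rho> powr - s\<close> of \<open>osc\<close> leaves
    \<open>1 / Suc n\<close>.\<close>
  define E where "E n = {x. \<exists>\<^sub>F \<rho> in at_right 0. ennreal (1 / (C * Suc n) * \<rho> powr s) \<le> I x \<rho>}" for n
  have "hausdorff_measure s (E n) = 0" for n
    unfolding E_def I_def
    using C q by (intro hausdorff_null_kernel[OF k fin _ _ s]) (auto simp: k_def)
  then have "hausdorff_measure s (\<Union>n. E n) = 0" by (rule hausdorff_null_UN)
  moreover have "{x \<in> S. \<not> ((\<lambda>\<rho>. mean_osc q u (ball x \<rho>)) \<longlongrightarrow> 0) (at_right 0)} \<subseteq> (\<Union>n. E n)"
  proof safe
    fix x assume x: "x \<in> S" and nlim: "\<not> ((\<lambda>\<rho>. mean_osc q u (ball x \<rho>)) \<longlongrightarrow> 0) (at_right 0)"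
    obtain e where e: "0 < e" "\<not> (\<forall>\<^sub>F \<rho> in at_right 0. mean_osc q u (ball x \<rho>) < e)"
    proof (rule ccontr)
      assume "\<not> thesis"
      then have "\<And>e. 0 < e \<Longrightarrow> \<forall>\<^sub>F \<rho> in at_right 0. mean_osc q u (ball x \<rho>) < e"
        using that by blast
      then have "((\<lambda>\<rho>. mean_osc q u (ball x \<rho>)) \<longlongrightarrow> 0) (at_right 0)"
        by (intro order_tendstoI) auto
      with nlim show False ..
    qed
    obtain e' where e': "0 < e'" "e' < e" using e(1) dense by blast
    then obtain b where b: "e' = ennreal b" "0 < b" by (cases e') auto
    obtain n where n: "1 / Suc n < b" using b(2) reals_Archimedean by (metis inverse_eq_divide)
    have "\<exists>\<^sub>F \<rho> in at_right 0. \<not> mean_osc q u (ball x \<rho>) < e"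
      using e(2) by (simp add: frequently_def)
    moreover have "\<forall>\<^sub>F \<rho> in at_right 0. 0 < \<rho> \<and> ball x \<rho> \<subseteq> S"
      using eventually_at_right_less[of "0::real"] eventually_at_right_ball_subset[OF S x]
      by (rule eventually_conj)
    ultimately have "\<exists>\<^sub>F \<rho> in at_right 0. (0 < \<rho> \<and> ball x \<rho> \<subseteq> S) \<and> \<not> mean_osc q u (ball x \<rho>) < e"
      by (rule frequently_eventually_conj)
    then have "\<exists>\<^sub>F \<rho> in at_right 0. ennreal (1 / (C * Suc n) * \<rho> powr s) \<le> I x \<rho>"
    proof (rule frequently_elim1)
      fix \<rho> assume \<rho>: "(0 < \<rho> \<and> ball x \<rho> \<subseteq> S) \<and> \<not> mean_osc q u (ball x \<rho>) < e"
      show "ennreal (1 / (C * Suc n) * \<rho> powr s) \<le> I x \<rho>"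
      \<comment> \<open>An infinite \<open>I x \<rho>\<close> satisfies the bound trivially; for a
        finite one, \<open>osc\<close> is solved for it in the reals.\<close>
      proof (cases "I x \<rho>")
        case (real i)
        have "ennreal (1 / Suc n) \<le> e'" using n b by (simp add: ennreal_leI)
        also have "\<dots> \<le> mean_osc q u (ball x \<rho>)" using \<rho> e'(2) by (meson not_less less_imp_le order_trans)
        also have "\<dots> \<le> ennreal (C * \<rho> powr - s) * I x \<rho>" using \<rho> by (intro osc) auto
        also have "\<dots> = ennreal (C * \<rho> powr - s * i)" using real C by (simp add: ennreal_mult')
        finally have "1 / Suc n \<le> C * \<rho> powr - s * i"
          using real C by (subst (asm) ennreal_le_iff) auto
        then have "1 / (C * Suc n) * \<rho> powr s \<le> i"
          using \<rho> C by (simp add: powr_minus field_simps del: of_nat_Suc)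
        then show ?thesis using real by (simp add: ennreal_leI)
      qed simp
    qed
    then show "x \<in> (\<Union>n. E n)" unfolding E_def by blast
  qed
  ultimately show ?thesis unfolding s_def by (rule hausdorff_null_subset)
qed

text \<open>Each point of \<open>S\<close> has a ball compactly contained in \<open>S\<close>, on
  which \<open>u\<close> is of class \<open>frac_sobolev\<close>. By Lindelof's theorem countably
  many open sets with this property cover \<open>S\<close>. Convergence at a point does not refer to
  the set chosen around it, so the exceptional set is a countable union of null sets.\<close>

lemma hausdorff_null_mean_osc_loc:
  fixes u :: "'a::euclidean_space \<Rightarrow> 'b::euclidean_space" and q r :: real
  assumes S: "open S" and u: "u \<in> frac_sobolev_loc r q S" and q: "1 \<le> q" and r: "0 < r" and rq: "r * q \<le> real DIM('a)"
  shows "hausdorff_measure (real DIM('a) - r * q)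
    {x \<in> S. \<not> ((\<lambda>\<rho>. mean_osc q u (ball x \<rho>)) \<longlongrightarrow> 0) (at_right 0)} = 0"
proof -
  define \<F> where "\<F> = {B. B \<subseteq> S \<and> open B \<and> u \<in> frac_sobolev r q B}"
  define Z where "Z B = {x \<in> B. \<not> ((\<lambda>\<rho>. mean_osc q u (ball x \<rho>)) \<longlongrightarrow> 0) (at_right 0)}" for B
  obtain \<F>' where \<F>': "\<F>' \<subseteq> \<F>" "countable \<F>'" "\<Union>\<F>' = \<Union>\<F>"
    by (rule Lindelof[of \<F>]) (auto simp: \<F>_def)
  have "S \<subseteq> \<Union>\<F>"
  proof
    fix x assume "x \<in> S"
    then obtain e where e: "0 < e" "cball x e \<subseteq> S" using S by (auto simp: open_contains_cball)
    then have "u \<in> frac_sobolev r q (ball x e)"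
      using u by (simp add: frac_sobolev_loc_def)
    moreover have "ball x e \<subseteq> S" using e ball_subset_cball by blast
    ultimately show "x \<in> \<Union>\<F>" using e(1) by (auto simp: \<F>_def intro!: exI[of _ "ball x e"])
  qed
  then have "Z S \<subseteq> \<Union>(Z ` \<F>')" using \<F>'(3) unfolding Z_def by blast
  moreover have "hausdorff_measure (real DIM('a) - r * q) (\<Union>(Z ` \<F>')) = 0"
  proof (rule hausdorff_null_countable_Union)
    fix A assume "A \<in> Z ` \<F>'"
    then obtain B where B: "A = Z B" "open B" "u \<in> frac_sobolev r q B" using \<F>'(1) by (auto simp: \<F>_def)
    show "hausdorff_measure (real DIM('a) - r * q) A = 0"
      unfolding B(1) Z_def by (rule hausdorff_null_mean_osc[OF B(2,3) q r rq])
  qed (use \<F>'(2) in simp)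
  ultimately show ?thesis unfolding Z_def by (rule hausdorff_null_subset[rotated])
qed

theorem theorem1p7:
  fixes \<Omega> :: "(real ^ 'n) set"
    and u :: "real ^ 'n \<Rightarrow> real ^ 'd"
    and q r :: real
  assumes "open \<Omega>"
    and "1 \<le> q" and "0 < r" and "r < 1"
    and "r * q \<le> real CARD('n)"
    and "u \<in> frac_sobolev_loc r q \<Omega>"
  shows "hausdorff_measure (real CARD('n) - r * q)
           {x \<in> \<Omega>. \<not> (
              ((\<lambda>\<rho>. nn_average (ball x \<rho>)
                 (\<lambda>z. ennreal (norm (u z - average (ball x \<rho>) u) powr q))) \<longlongrightarrow> 0) (at_right 0) \<and>
              ((\<lambda>\<rho>. nn_average (ball x \<rho>)
                 (\<lambda>z. nn_average (ball x \<rho>) (\<lambda>y. ennreal (norm (u z - u y) powr q)))) \<longlongrightarrow> 0) (at_right 0))} = 0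
       \<and> hausdorff_measure (real CARD('n) - r * q) (approx_singular_set \<Omega> u) = 0"
proof -
  \<comment> \<open>Both exceptional sets of the theorem are contained in \<open>?Z\<close>:
    wherever \<open>mean_osc\<close> tends to 0, the other two limits hold as well.\<close>
  let ?Z = "{x \<in> \<Omega>. \<not> ((\<lambda>\<rho>. mean_osc q u (ball x \<rho>)) \<longlongrightarrow> 0) (at_right 0)}"
  have null: "hausdorff_measure (real CARD('n) - r * q) ?Z = 0"
    using hausdorff_null_mean_osc_loc[of \<Omega> u r q] assms by simp
  have good: "((\<lambda>\<rho>. nn_average (ball x \<rho>)
        (\<lambda>z. ennreal (norm (u z - average (ball x \<rho>) u) powr q))) \<longlongrightarrow> 0) (at_right 0)"
      "((\<lambda>\<rho>. INF c. nn_average (ball x \<rho>) (\<lambda>y. ennreal (norm (u y - c)))) \<longlongrightarrow> 0) (at_right 0)"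
    if "x \<in> \<Omega>" and lim: "((\<lambda>\<rho>. mean_osc q u (ball x \<rho>)) \<longlongrightarrow> 0) (at_right 0)" for x
  proof -
    \<comment> \<open>Global integrability on \<open>\<Omega>\<close> is not given, so the limits
      are derived on a ball around \<open>x\<close> whose closure lies in
      \<open>\<Omega>\<close>.\<close>
    obtain e where e: "0 < e" "cball x e \<subseteq> \<Omega>"
      using \<open>open \<Omega>\<close> \<open>x \<in> \<Omega>\<close> by (auto simp: open_contains_cball)
    then have "u \<in> Lq q (ball x e)"
      using assms(6) by (simp add: frac_sobolev_loc_def frac_sobolev_def)
    then show "((\<lambda>\<rho>. nn_average (ball x \<rho>)
        (\<lambda>z. ennreal (norm (u z - average (ball x \<rho>) u) powr q))) \<longlongrightarrow> 0) (at_right 0)"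
      "((\<lambda>\<rho>. INF c. nn_average (ball x \<rho>) (\<lambda>y. ennreal (norm (u y - c)))) \<longlongrightarrow> 0) (at_right 0)"
      using mean_osc_tendsto_imp_Lq[OF open_ball _ _ \<open>1 \<le> q\<close> lim, of x e] e(1) by simp_all
  qed
  show ?thesis
  proof
    show "hausdorff_measure (real CARD('n) - r * q)
           {x \<in> \<Omega>. \<not> (
              ((\<lambda>\<rho>. nn_average (ball x \<rho>)
                 (\<lambda>z. ennreal (norm (u z - average (ball x \<rho>) u) powr q))) \<longlongrightarrow> 0) (at_right 0) \<and>
              ((\<lambda>\<rho>. nn_average (ball x \<rho>)
                 (\<lambda>z. nn_average (ball x \<rho>) (\<lambda>y. ennreal (norm (u z - u y) powr q)))) \<longlongrightarrow> 0) (at_right 0))} = 0"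
      \<comment> \<open>The double average in the goal is \<open>mean_osc\<close> itself, so
        \<open>good(1)\<close> supplies the only limit that remains.\<close>
      using good(1) unfolding mean_osc_def[symmetric] by (intro hausdorff_null_subset[OF null]) blast
    show "hausdorff_measure (real CARD('n) - r * q) (approx_singular_set \<Omega> u) = 0"
      using good(2) unfolding approx_singular_set_def by (intro hausdorff_null_subset[OF null]) blast
  qed
qed

end
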